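(* Let $\mathcal{X}$ be a nonempty finite set, let $\mu:\mathcal{X}\to(0,\infty)$, and let $\mathcal{B}\subset\mathbb{R}^{\mathcal{X}}$ be a linear subspace containing the constant function $\mathbf{1}$. Let $n\ge 1$ and $x_1,\ldots,x_n\in\mathcal{X}$. Then the maximum likelihood estimator (MLE) for $e(\mathcal{B})$ and $x_1,\ldots,x_n$ exists if and only if $\{x_1,\ldots,x_n\}$ is a set of uniqueness for $\mathcal{B}_+$.
   Context: For $\phi\in\mathbb{R}^{\mathcal{X}}$ let $Z(\phi)=\sum_{x\in\mathcal{X}}e^{\phi(x)}\mu(x)$, $\psi(\phi)=\log Z(\phi)$, and let $e(\phi)=e^{\phi-\psi(\phi)}$, a positive function on $\mathcal{X}$. The exponential family spanned by $\mathcal{B}$ is $e(\mathcal{B})=\{e(\phi):\phi\in\mathcal{B}\}$. The likelihood of $p\in e(\mathcal{B})$ is $L_p(x_1,\ldots,x_n)=\prod_{i=1}^n p(x_i)$. An element $\hat p\in e(\mathcal{B})$ is called the MLE for $e(\mathcal{B})$ and $x_1,\ldots,x_n$ if $L_{\hat p}(x_1,\ldots,x_n)=\sup_{p\in e(\mathcal{B})}L_p(x_1,\ldots,x_n)$. Let $\mathcal{B}_+=\{\phi\in\mathcal{B}:\phi\ge 0\text{ on }\mathcal{X}\}$. A set $U\subset\mathcal{X}$ is a set of uniqueness for $\mathcal{B}_+$ if the only $\phi\in\mathcal{B}_+$ with $\phi=0$ on $U$ is $\phi=0$. *)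

theory Defs
  imports "HOL-Analysis.Analysis"
begin

text \<open>
  The nonempty finite set \<open>\<X>\<close> is a type \<open>'x\<close> of class \<open>finite\<close>, and \<open>\<real>\<^sup>\<X>\<close> is the
  real vector space \<open>real ^ 'x\<close>, so that linear subspaces are those of the library.
\<close>

definition partition_fun :: "('x::finite \<Rightarrow> real) \<Rightarrow> real ^ 'x \<Rightarrow> real" where
  "partition_fun \<mu> \<phi> = (\<Sum>x\<in>UNIV. exp (\<phi> $ x) * \<mu> x)"

definition log_partition :: "('x::finite \<Rightarrow> real) \<Rightarrow> real ^ 'x \<Rightarrow> real" where
  "log_partition \<mu> \<phi> = ln (partition_fun \<mu> \<phi>)"

definition exp_density :: "('x::finite \<Rightarrow> real) \<Rightarrow> real ^ 'x \<Rightarrow> real ^ 'x" where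
  "exp_density \<mu> \<phi> = (\<chi> x. exp (\<phi> $ x - log_partition \<mu> \<phi>))"

definition exp_family :: "('x::finite \<Rightarrow> real) \<Rightarrow> (real ^ 'x) set \<Rightarrow> (real ^ 'x) set" where
  "exp_family \<mu> B = exp_density \<mu> ` B"

text \<open>A sample \<open>x\<^sub>1, \<dots>, x\<^sub>n\<close> is given by \<open>x :: nat \<Rightarrow> 'x\<close>; only its values on \<open>{1..n}\<close> matter.\<close>

definition likelihood :: "nat \<Rightarrow> (nat \<Rightarrow> 'x::finite) \<Rightarrow> real ^ 'x \<Rightarrow> real" where
  "likelihood n x p = (\<Prod>i=1..n. p $ x i)"

text \<open>
  For \<open>\<mu> > 0\<close> and nonempty \<open>B\<close> the supremum below is the actual least upper bound: every
  \<open>p\<close> in the exponential family satisfies \<open>0 < p $ y \<le> 1 / \<mu> y\<close>, so the likelihoods are bounded.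
\<close>

definition is_MLE ::
  "('x::finite \<Rightarrow> real) \<Rightarrow> (real ^ 'x) set \<Rightarrow> nat \<Rightarrow> (nat \<Rightarrow> 'x) \<Rightarrow> real ^ 'x \<Rightarrow> bool" where
  "is_MLE \<mu> B n x q \<longleftrightarrow>
     q \<in> exp_family \<mu> B \<and>
     likelihood n x q = (SUP p\<in>exp_family \<mu> B. likelihood n x p)"

definition nonneg_part :: "(real ^ 'x::finite) set \<Rightarrow> (real ^ 'x) set" where
  "nonneg_part B = {\<phi> \<in> B. \<forall>x. 0 \<le> \<phi> $ x}"

definition set_of_uniqueness :: "'x::finite set \<Rightarrow> (real ^ 'x) set \<Rightarrow> bool" where
  "set_of_uniqueness U C \<longleftrightarrow> (\<forall>\<phi>\<in>C. (\<forall>x\<in>U. \<phi> $ x = 0) \<longrightarrow> \<phi> = 0)"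

end

theory Submission
  imports Defs
begin

text \<open>
  With \<open>Z\<close> the partition function, the likelihood of the member of the family with
  potential \<open>\<phi>\<close> is \<open>exp (\<Sum>i. \<phi> (x\<^sub>i)) / Z(\<phi>)\<^sup>n\<close>. Both directions rest on this formula.

  If some nonzero \<open>\<phi> \<ge> 0\<close> in \<open>B\<close> vanishes on the sample, then replacing a potential \<open>\<theta>\<close> by
  \<open>\<theta> - \<phi>\<close> keeps the numerator and strictly decreases \<open>Z\<close>. So every likelihood can be
  improved and no maximum exists.

  Conversely, adding a constant to \<open>\<phi>\<close> does not change the density. Since \<open>B\<close> contains the
  constants, only the subspace \<open>V\<close> of potentials in \<open>B\<close> with \<open>(\<Sum>i. \<phi> (x\<^sub>i)) = 0\<close> matters, and
  on it maximising the likelihood means minimising \<open>Z\<close>. A \<open>\<phi> \<in> V\<close> that is nowhere positive must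
  vanish at all sample points, so uniqueness applied to \<open>-\<phi>\<close> gives \<open>\<phi> = 0\<close>. Hence the positively
  homogeneous function \<open>\<Sum>y. \<mu> y * max 0 (\<phi> y)\<close> is positive on \<open>V - {0}\<close>, and by compactness of
  the unit sphere it is at least \<open>\<delta> * norm \<phi>\<close> for some \<open>\<delta> > 0\<close>. As \<open>exp t \<ge> max 0 t\<close>, the same
  lower bound holds for \<open>Z\<close>. So \<open>Z\<close> is coercive on \<open>V\<close> and attains its minimum there.
\<close>

lemma partition_fun_pos:
  assumes "\<And>y. \<mu> y > 0"
  shows "partition_fun \<mu> \<phi> > 0"
  unfolding partition_fun_def by (rule sum_pos) (auto simp: assms)

lemma exp_density_nth:
  assumes "\<And>y. \<mu> y > 0"
  shows "exp_density \<mu> \<phi> $ y = exp (\<phi> $ y) / partition_fun \<mu> \<phi>"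
  using partition_fun_pos[of \<mu> \<phi>, OF assms]
  by (simp add: exp_density_def log_partition_def exp_diff)

lemma likelihood_exp_density:
  assumes "\<And>y. \<mu> y > 0"
  shows "likelihood n x (exp_density \<mu> \<phi>) = exp (\<Sum>i=1..n. \<phi> $ x i) / partition_fun \<mu> \<phi> ^ n"
  by (simp add: likelihood_def exp_density_nth[of \<mu>, OF assms] prod_dividef exp_sum)

lemma exp_density_add_const:
  assumes "\<And>y. \<mu> y > 0"
  shows "exp_density \<mu> (\<phi> + c *\<^sub>R (\<chi> y. 1)) = exp_density \<mu> \<phi>"
proof -
  have "partition_fun \<mu> (\<phi> + c *\<^sub>R (\<chi> y. 1)) = exp c * partition_fun \<mu> \<phi>"
    by (simp add: partition_fun_def exp_add sum_distrib_left mult_ac)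
  then show ?thesis
    by (simp add: vec_eq_iff exp_density_nth[of \<mu>, OF assms] exp_add)
qed

text \<open>
  A density \<open>p\<close> satisfies \<open>p y * \<mu> y \<le> 1\<close> because its terms \<open>p y * \<mu> y\<close> sum to \<open>1\<close>. Without this
  bound the supremum of the likelihoods would be an unspecified value.
\<close>

lemma bdd_above_likelihood_exp_family:
  assumes "\<And>y. \<mu> y > 0"
  shows "bdd_above (likelihood n x ` exp_family \<mu> B)"
proof (rule bdd_aboveI2)
  fix p assume "p \<in> exp_family \<mu> B"
  then obtain \<phi> where p: "p = exp_density \<mu> \<phi>"
    by (auto simp: exp_family_def)
  have "0 \<le> p $ y \<and> p $ y \<le> 1 / \<mu> y" for y
  proof -
    have "exp (\<phi> $ y) * \<mu> y \<le> partition_fun \<mu> \<phi>"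
      unfolding partition_fun_def
      by (rule member_le_sum) (auto intro!: mult_nonneg_nonneg less_imp_le[OF assms])
    then show ?thesis
      using partition_fun_pos[of \<mu> \<phi>, OF assms] assms[of y]
      by (simp add: p exp_density_nth[of \<mu>, OF assms] field_simps)
  qed
  then show "likelihood n x p \<le> (\<Prod>i=1..n. 1 / \<mu> (x i))"
    unfolding likelihood_def by (intro prod_mono) auto
qed

lemma partition_fun_diff_less:
  assumes "\<And>y. \<mu> y > 0" and "\<And>y. 0 \<le> \<phi> $ y" and "\<phi> \<noteq> 0"
  shows "partition_fun \<mu> (\<theta> - \<phi>) < partition_fun \<mu> \<theta>"
proof -
  obtain z where "\<phi> $ z \<noteq> 0"
    using \<open>\<phi> \<noteq> 0\<close> by (auto simp: vec_eq_iff)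
  with assms(2)[of z] have "\<phi> $ z > 0"
    by simp
  then show ?thesis
    unfolding partition_fun_def
    by (intro sum_strict_mono_ex1 bexI[of _ z] ballI)
       (auto intro!: mult_right_mono mult_strict_right_mono less_imp_le[OF assms(1)] assms)
qed

text \<open>By homogeneity it is enough to bound \<open>g\<close> below on the unit sphere of \<open>S\<close>, which is compact.\<close>

lemma homogeneous_pos_ge_norm:
  fixes g :: "'a::euclidean_space \<Rightarrow> real"
  assumes "closed S" and "cone S" and "continuous_on S g"
    and hom: "\<And>c v. c \<ge> 0 \<Longrightarrow> g (c *\<^sub>R v) = c * g v"
    and pos: "\<And>v. v \<in> S \<Longrightarrow> v \<noteq> 0 \<Longrightarrow> g v > 0"
  obtains \<delta> where "\<delta> > 0" and "\<And>v. v \<in> S \<Longrightarrow> \<delta> * norm v \<le> g v"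
proof -
  have "\<exists>\<delta>>0. \<forall>u\<in>S \<inter> sphere 0 1. \<delta> \<le> g u"
  proof (cases "S \<inter> sphere 0 1 = {}")
    case True
    then show ?thesis by (auto intro: exI[of _ 1])
  next
    case False
    have "compact (S \<inter> sphere 0 1)"
      using \<open>closed S\<close> by (intro closed_Int_compact) auto
    then obtain u where "u \<in> S \<inter> sphere 0 1" and "\<forall>v\<in>S \<inter> sphere 0 1. g u \<le> g v"
      using continuous_attains_inf[OF _ False continuous_on_subset[OF \<open>continuous_on S g\<close>]]
      by blast
    then show ?thesis
      using pos[of u] by (intro exI[of _ "g u"]) (cases "u = 0"; auto)
  qed
  then obtain \<delta> where "\<delta> > 0" and \<delta>: "\<And>u. u \<in> S \<Longrightarrow> norm u = 1 \<Longrightarrow> \<delta> \<le> g u"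
    by auto
  have "\<delta> * norm v \<le> g v" if "v \<in> S" for v
  proof (cases "v = 0")
    case True
    then show ?thesis using hom[of 0 v] by simp
  next
    case False
    have "\<delta> \<le> g (inverse (norm v) *\<^sub>R v)"
      using False \<open>cone S\<close> that by (intro \<delta>) (auto simp: cone_def)
    then show ?thesis
      using False by (simp add: hom field_simps)
  qed
  with \<open>\<delta> > 0\<close> show thesis
    using that by blast
qed

lemma continuous_on_partition_fun: "continuous_on S (partition_fun \<mu>)"
  unfolding partition_fun_def[abs_def] by (intro continuous_intros)

text \<open>
  Along every ray from \<open>0\<close> in \<open>V\<close> some coordinate tends to \<open>+\<infinity>\<close>, and so does \<open>Z\<close>. The
  function \<open>g\<close> in the proof is a positively homogeneous minorant of \<open>Z\<close> that makes this growth
  uniform over all rays.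
\<close>

lemma partition_fun_attains_min:
  fixes V :: "(real ^ 'x::finite) set"
  assumes \<mu>: "\<And>y. \<mu> y > 0" and V: "subspace V"
    and nonpos: "\<And>\<phi>. \<phi> \<in> V \<Longrightarrow> (\<And>y. \<phi> $ y \<le> 0) \<Longrightarrow> \<phi> = 0"
  obtains \<theta> where "\<theta> \<in> V" and "\<And>\<phi>. \<phi> \<in> V \<Longrightarrow> partition_fun \<mu> \<theta> \<le> partition_fun \<mu> \<phi>"
proof -
  define g :: "real ^ 'x \<Rightarrow> real" where "g \<phi> = (\<Sum>y\<in>UNIV. \<mu> y * max 0 (\<phi> $ y))" for \<phi>
  have g_hom: "g (c *\<^sub>R \<phi>) = c * g \<phi>" if "c \<ge> 0" for c \<phi>
  proof -
    have "\<mu> y * max 0 ((c *\<^sub>R \<phi>) $ y) = c * (\<mu> y * max 0 (\<phi> $ y))" for y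
      using that by (cases "c = 0") (simp_all add: max_def zero_le_mult_iff)
    then show ?thesis
      unfolding g_def sum_distrib_left by (intro sum.cong) auto
  qed
  have g_pos: "g \<phi> > 0" if \<phi>: "\<phi> \<in> V" "\<phi> \<noteq> 0" for \<phi>
  proof -
    obtain z where "\<phi> $ z > 0"
      using nonpos[OF \<phi>(1)] \<phi>(2) by (meson not_le)
    then show ?thesis
      unfolding g_def using \<mu>
      by (intro sum_pos2[of _ z]) (auto intro!: mult_nonneg_nonneg less_imp_le[OF \<mu>])
  qed
  have "cone V"
    using V by (auto simp: cone_def subspace_def)
  moreover have "continuous_on V g"
    unfolding g_def[abs_def] by (intro continuous_intros)
  ultimately obtain \<delta> where "\<delta> > 0" and \<delta>: "\<And>\<phi>. \<phi> \<in> V \<Longrightarrow> \<delta> * norm \<phi> \<le> g \<phi>"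
    using homogeneous_pos_ge_norm[of V g] closed_subspace[OF V] g_hom g_pos by blast
  have "t \<le> exp t" for t :: real
    using exp_ge_add_one_self[of t] by linarith
  then have "max 0 t \<le> exp t" for t :: real
    by simp
  then have g_le: "g \<phi> \<le> partition_fun \<mu> \<phi>" for \<phi>
    unfolding g_def partition_fun_def
    by (intro sum_mono) (simp add: mult.commute mult_left_mono less_imp_le[OF \<mu>])
  \<comment> \<open>On \<open>V\<close>, outside this ball \<open>Z\<close> exceeds its value at \<open>0\<close>.\<close>
  define K where "K = V \<inter> cball 0 (partition_fun \<mu> 0 / \<delta>)"
  have "compact K"
    unfolding K_def using closed_subspace[OF V] by (intro closed_Int_compact) auto
  have "0 \<in> K"
    using V \<open>\<delta> > 0\<close> partition_fun_pos[of \<mu> 0, OF \<mu>] by (simp add: K_def subspace_0)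
  then have "K \<noteq> {}"
    by blast
  then obtain \<theta> where \<theta>: "\<theta> \<in> K" "\<And>\<phi>. \<phi> \<in> K \<Longrightarrow> partition_fun \<mu> \<theta> \<le> partition_fun \<mu> \<phi>"
    using continuous_attains_inf[OF \<open>compact K\<close> _ continuous_on_partition_fun[of K \<mu>]] by auto
  have "partition_fun \<mu> \<theta> \<le> partition_fun \<mu> \<phi>" if "\<phi> \<in> V" for \<phi>
  proof (cases "\<phi> \<in> K")
    case False
    then have "partition_fun \<mu> 0 \<le> \<delta> * norm \<phi>"
      using that \<open>\<delta> > 0\<close> by (simp add: K_def field_simps)
    then show ?thesis
      using \<theta>(2)[OF \<open>0 \<in> K\<close>] \<delta>[OF that] g_le[of \<phi>] by linarith
  qed (rule \<theta>(2))
  then show thesis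
    using that \<theta>(1) by (auto simp: K_def)
qed

theorem theorem2p2:
  fixes \<mu> :: "'x::finite \<Rightarrow> real"
    and B :: "(real ^ 'x) set"
    and n :: nat
    and x :: "nat \<Rightarrow> 'x"
  assumes "\<And>y. \<mu> y > 0"
    and "subspace B"
    and "(\<chi> y. 1) \<in> B"
    and "n \<ge> 1"
  shows "(\<exists>q. is_MLE \<mu> B n x q) \<longleftrightarrow> set_of_uniqueness (x ` {1..n}) (nonneg_part B)"
proof
  note Z_pos = partition_fun_pos[of \<mu>, OF assms(1)]
  note likelihood_eq = likelihood_exp_density[of \<mu>, OF assms(1)]
  assume "\<exists>q. is_MLE \<mu> B n x q"
  then obtain \<theta> where \<theta>: "\<theta> \<in> B"
    and max: "likelihood n x (exp_density \<mu> \<theta>) = (SUP p\<in>exp_family \<mu> B. likelihood n x p)"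
    by (auto simp: is_MLE_def exp_family_def)
  show "set_of_uniqueness (x ` {1..n}) (nonneg_part B)"
    unfolding set_of_uniqueness_def
  proof (intro ballI impI, rule ccontr)
    fix \<phi> assume \<phi>: "\<phi> \<in> nonneg_part B" and vanish: "\<forall>y\<in>x ` {1..n}. \<phi> $ y = 0" and "\<phi> \<noteq> 0"
    have "exp_density \<mu> (\<theta> - \<phi>) \<in> exp_family \<mu> B"
      using \<phi> \<theta> \<open>subspace B\<close> by (auto simp: exp_family_def nonneg_part_def subspace_diff)
    then have "likelihood n x (exp_density \<mu> (\<theta> - \<phi>)) \<le> likelihood n x (exp_density \<mu> \<theta>)"
      unfolding max
      by (intro cSUP_upper bdd_above_likelihood_exp_family assms(1))
    moreover have "(\<Sum>i=1..n. (\<theta> - \<phi>) $ x i) = (\<Sum>i=1..n. \<theta> $ x i)"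
      using vanish by (intro sum.cong) auto
    moreover have "partition_fun \<mu> (\<theta> - \<phi>) ^ n < partition_fun \<mu> \<theta> ^ n"
      using \<phi> \<open>\<phi> \<noteq> 0\<close> \<open>n \<ge> 1\<close> Z_pos[of "\<theta> - \<phi>"]
      by (intro power_strict_mono partition_fun_diff_less assms(1)) (auto simp: nonneg_part_def)
    ultimately show False
      using Z_pos[of \<theta>] Z_pos[of "\<theta> - \<phi>"]
      by (simp add: likelihood_eq field_simps)
  qed
next
  note Z_pos = partition_fun_pos[of \<mu>, OF assms(1)]
  note likelihood_eq = likelihood_exp_density[of \<mu>, OF assms(1)]
  assume unique: "set_of_uniqueness (x ` {1..n}) (nonneg_part B)"
  define V where "V = {\<phi> \<in> B. (\<Sum>i=1..n. \<phi> $ x i) = 0}"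
  have "subspace V"
    using \<open>subspace B\<close>
    by (auto simp: V_def subspace_def sum.distrib simp flip: sum_distrib_left)
  moreover have "\<phi> = 0" if "\<phi> \<in> V" and nonpos: "\<And>y. \<phi> $ y \<le> 0" for \<phi>
  proof -
    have "(\<Sum>i=1..n. - \<phi> $ x i) = 0"
      using \<open>\<phi> \<in> V\<close> by (simp add: V_def sum_negf)
    then have "\<forall>i\<in>{1..n}. - \<phi> $ x i = 0"
      using nonpos by (subst (asm) sum_nonneg_eq_0_iff) auto
    moreover have "- \<phi> \<in> nonneg_part B"
      using that \<open>subspace B\<close> by (auto simp: V_def nonneg_part_def subspace_neg)
    ultimately have "- \<phi> = 0"
      using unique unfolding set_of_uniqueness_def by (metis imageE vector_uminus_component)
    then show ?thesis by simp
  qed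
  ultimately obtain \<theta> where "\<theta> \<in> V"
    and \<theta>: "\<And>\<phi>. \<phi> \<in> V \<Longrightarrow> partition_fun \<mu> \<theta> \<le> partition_fun \<mu> \<phi>"
    using partition_fun_attains_min[of \<mu> V, OF assms(1)] by blast
  have best: "likelihood n x (exp_density \<mu> \<phi>) \<le> likelihood n x (exp_density \<mu> \<theta>)"
    if "\<phi> \<in> B" for \<phi>
  proof -
    \<comment> \<open>Subtracting the sample mean moves \<open>\<phi>\<close> into \<open>V\<close> without changing its density.\<close>
    define c where "c = - (\<Sum>i=1..n. \<phi> $ x i) / n"
    define \<phi>' where "\<phi>' = \<phi> + c *\<^sub>R (\<chi> y. 1)"
    have "(\<Sum>i=1..n. \<phi>' $ x i) = 0"
      using \<open>n \<ge> 1\<close> by (simp add: \<phi>'_def sum.distrib) (simp add: c_def)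
    moreover have "\<phi>' \<in> B"
      using that assms(2,3) by (simp add: \<phi>'_def subspace_add subspace_scale)
    ultimately have "\<phi>' \<in> V"
      by (simp add: V_def)
    have "likelihood n x (exp_density \<mu> \<phi>) = likelihood n x (exp_density \<mu> \<phi>')"
      by (simp add: \<phi>'_def exp_density_add_const[of \<mu>, OF assms(1)])
    also have "\<dots> = 1 / partition_fun \<mu> \<phi>' ^ n"
      using \<open>\<phi>' \<in> V\<close> by (simp add: likelihood_eq V_def)
    also have "\<dots> \<le> 1 / partition_fun \<mu> \<theta> ^ n"
      using \<theta>[OF \<open>\<phi>' \<in> V\<close>] Z_pos[of \<theta>] by (intro divide_left_mono power_mono mult_pos_pos) auto
    also have "\<dots> = likelihood n x (exp_density \<mu> \<theta>)"
      using \<open>\<theta> \<in> V\<close> by (simp add: likelihood_eq V_def)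
    finally show ?thesis .
  qed
  have "exp_density \<mu> \<theta> \<in> exp_family \<mu> B"
    using \<open>\<theta> \<in> V\<close> by (auto simp: exp_family_def V_def)
  then have "(SUP p\<in>exp_family \<mu> B. likelihood n x p) = likelihood n x (exp_density \<mu> \<theta>)"
    using best by (intro cSup_eq_maximum) (auto simp: exp_family_def)
  with \<open>exp_density \<mu> \<theta> \<in> exp_family \<mu> B\<close> show "\<exists>q. is_MLE \<mu> B n x q"
    by (auto simp: is_MLE_def intro!: exI[of _ "exp_density \<mu> \<theta>"])
qed

end
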